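(* Let $F$ be a subexponential distribution on $\mathbb{R}$. Suppose that $G_1,\dots,G_n$ are distributions on $\mathbb{R}$ such that, for each $k=1,\dots,n$, the measure $F+G_k$ is long-tailed and $\overline{G_k}(x)=O(\overline{F}(x))$ as $x\to\infty$. Suppose additionally that $G_1$ is long-tailed and that $G_1$ is weakly tail equivalent to $F$. Then $G_1*\dots*G_n$ is subexponential, and additionally $G_1*\dots*G_n$ is weakly tail equivalent to $F$.
   Context: A distribution is a (Borel) probability measure on $\mathbb{R}$. For a finite Borel measure $F$ on $\mathbb{R}$ the tail function is $\overline{F}(x)=F((x,\infty))$; $F*G$ denotes convolution. A finite measure $F$ on $\mathbb{R}$ is long-tailed if $\overline{F}(x)>0$ for all $x$ and, for every constant $a\in\mathbb{R}$, $\overline{F}(x+a)/\overline{F}(x)\to 1$ as $x\to\infty$. A distribution $F$ on $\mathbb{R}$ is subexponential if it is long-tailed and $\overline{F*F}(x)=2\overline{F}(x)+o(\overline{F}(x))$ as $x\to\infty$. Distributions $F$ and $G$ on $\mathbb{R}$ are weakly tail equivalent if both $\overline{F}(x)=O(\overline{G}(x))$ and $\overline{G}(x)=O(\overline{F}(x))$ as $x\to\infty$. *)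

theory Defs
  imports "HOL-Probability.Probability" "HOL-Library.Landau_Symbols"
begin

definition tail :: "real measure \<Rightarrow> real \<Rightarrow> real" where
  "tail F x = measure F {x<..}"

definition add_measure :: "real measure \<Rightarrow> real measure \<Rightarrow> real measure" where
  "add_measure F G = measure_of UNIV (sets borel) (\<lambda>A. emeasure F A + emeasure G A)"

lemma sets_add_measure [simp]: "sets (add_measure F G) = sets borel"
  using sets.sets_measure_of_eq [of "borel :: real measure"] by (simp add: add_measure_def)

lemma emeasure_add_measure:
  assumes F: "sets F = sets borel" and G: "sets G = sets borel" and A: "A \<in> sets borel"
  shows "emeasure (add_measure F G) A = emeasure F A + emeasure G A"
  unfolding add_measure_def
proof (rule emeasure_measure_of_sigma)
  show "sigma_algebra UNIV (sets (borel :: real measure))"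
    using sets.sigma_algebra_axioms [of "borel :: real measure"] by simp
  show "positive (sets (borel :: real measure)) (\<lambda>A. emeasure F A + emeasure G A)"
    by (simp add: positive_def)
  show "countably_additive (sets (borel :: real measure)) (\<lambda>A. emeasure F A + emeasure G A)"
    unfolding countably_additive_def
  proof (intro allI impI)
    fix B :: "nat \<Rightarrow> real set"
    assume "range B \<subseteq> sets borel" "disjoint_family B" "(\<Union>i. B i) \<in> sets borel"
    then show "(\<Sum>i. emeasure F (B i) + emeasure G (B i)) =
        emeasure F (\<Union>i. B i) + emeasure G (\<Union>i. B i)"
      using F G by (simp add: suminf_add [symmetric] suminf_emeasure)
  qed
qed (rule A)

definition long_tailed :: "real measure \<Rightarrow> bool" where
  "long_tailed F \<longleftrightarrow> finite_borel_measure F \<and> (\<forall>x. tail F x > 0) \<and>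
     (\<forall>a. ((\<lambda>x. tail F (x + a) / tail F x) \<longlongrightarrow> 1) at_top)"

definition subexponential :: "real measure \<Rightarrow> bool" where
  "subexponential F \<longleftrightarrow> real_distribution F \<and> long_tailed F \<and>
     (\<lambda>x. tail (F \<star> F) x - 2 * tail F x) \<in> o[at_top](tail F)"

definition weakly_tail_equivalent :: "real measure \<Rightarrow> real measure \<Rightarrow> bool" where
  "weakly_tail_equivalent F G \<longleftrightarrow> tail F \<in> O[at_top](tail G) \<and> tail G \<in> O[at_top](tail F)"

(* The left-associated convolution of G 1, ..., G n; the intended use is n >= 1. *)
definition iter_convolution :: "(nat \<Rightarrow> real measure) \<Rightarrow> nat \<Rightarrow> real measure" where
  "iter_convolution G n = foldl (\<star>) (G 1) (map G [2..<Suc n])"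

lemma iter_convolution_1: "iter_convolution G 1 = G 1"
  by (simp add: iter_convolution_def)

lemma iter_convolution_Suc:
  "n \<ge> 1 \<Longrightarrow> iter_convolution G (Suc n) = (iter_convolution G n \<star> G (Suc n))"
  by (simp add: iter_convolution_def)

end

theory Submission
  imports Defs
begin

text \<open>
  Measure everything on the scale of the reference tail of \<open>F\<close>. Call \<open>G\<close> insensitive when its
  tail is \<open>O(tail F)\<close> and every fixed shift changes that tail by only \<open>o(tail F)\<close>. Since \<open>F\<close> is
  long-tailed, the hypotheses on each \<open>G k\<close> make \<open>G k\<close> insensitive
  (\<open>insensitive_if_sum_long_tailed\<close>).

  The heart of the proof is \<open>tail_convolution_insensitive\<close>: for insensitive \<open>G\<close> and \<open>H\<close>,
  \<open>tail (G \<star> H) = tail G + tail H + o(tail F)\<close>. Let \<open>X\<close> and \<open>Y\<close> be independent with laws \<open>G\<close> and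
  \<open>H\<close>, and fix a large level \<open>a\<close>. If \<open>X + Y\<close> is large, then either one of the two variables is at
  most \<open>a\<close>, or both exceed \<open>a\<close>. In the first case that variable lies with high probability in
  \<open>{-a<..a}\<close>, so the other one is large up to a shift by \<open>a\<close>, which costs \<open>o(tail F)\<close>. The second event must be shown to be negligible.
  Conditioning on \<open>Y\<close> expresses its probability through values of \<open>tail G\<close> from \<open>a\<close> on, where
  \<open>tail G \<le> c * tail F\<close>, so \<open>G\<close> may be replaced by \<open>F\<close> at the price of a factor (\<open>both_large_mono\<close>);
  then \<open>H\<close> is replaced in the same way. For two independent variables with law \<open>F\<close>, the same
  splitting shows that moderate values of one of them already account for almost all of
  \<open>2 * tail F\<close>, so subexponentiality of \<open>F\<close> leaves only a small multiple of \<open>tail F\<close> for the event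
  that both are large (\<open>subexponential_both_large\<close>).

  It follows that insensitivity is preserved by convolution, and so is the property that
  \<open>tail F\<close> is big-O of the tail, which \<open>G 1\<close> brings in. Finally, an insensitive
  distribution \<open>P\<close> with \<open>tail F \<in> O(tail P)\<close> is subexponential: errors \<open>o(tail F)\<close> are then
  \<open>o(tail P)\<close>, and the key estimate with both factors equal to \<open>P\<close> is the definition.
\<close>

section \<open>Tails of measures on the line\<close>

lemma tail_nonneg [simp]: "0 \<le> tail F x"
  by (simp add: tail_def)

lemma tail_antimono:
  assumes "real_distribution F" "x \<le> y"
  shows "tail F y \<le> tail F x"
proof -
  interpret real_distribution F by fact
  show ?thesis
    unfolding tail_def using assms(2) by (intro finite_measure_mono) auto
qed

lemma borel_measurable_tail:
  assumes "real_distribution F"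
  shows "tail F \<in> borel_measurable borel"
proof -
  have "mono (\<lambda>x. - tail F x)"
    using tail_antimono[OF assms] by (auto intro: monoI)
  then have "(\<lambda>x. - (- tail F x)) \<in> borel_measurable borel"
    by (intro borel_measurable_uminus borel_measurable_mono)
  then show ?thesis
    by simp
qed

lemma tail_add_measure:
  assumes "real_distribution F" "real_distribution G"
  shows "tail (add_measure F G) x = tail F x + tail G x"
proof -
  interpret F: real_distribution F by fact
  interpret G: real_distribution G by fact
  show ?thesis
    by (simp add: tail_def measure_def emeasure_add_measure enn2real_plus less_top[symmetric])
qed

lemma eventually_mass_near_one:
  assumes "real_distribution G" "e > 0"
  shows "\<forall>\<^sub>F a in at_top. 1 - e < measure G {-a<..a}"
proof -
  interpret real_distribution G by fact
  have "((\<lambda>a. cdf G a - cdf G (-a)) \<longlongrightarrow> 1 - 0) at_top"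
    by (intro tendsto_diff cdf_lim_at_top_prob
          filterlim_compose[OF cdf_lim_at_bot filterlim_uminus_at_bot_at_top])
  then have "\<forall>\<^sub>F a in at_top. 1 - e < cdf G a - cdf G (-a)"
    by (rule order_tendstoD) (use assms(2) in simp)
  with eventually_gt_at_top[of 0] show ?thesis
    by eventually_elim (simp add: cdf_diff_eq)
qed

lemma long_tailed_shift_negligible:
  assumes "long_tailed F"
  shows "(\<lambda>x. tail F (x + a) - tail F x) \<in> o[at_top](tail F)"
proof (rule smalloI_tendsto)
  have pos: "tail F x > 0" for x
    using assms by (simp add: long_tailed_def)
  then show "\<forall>\<^sub>F x in at_top. tail F x \<noteq> 0"
    by (simp add: less_imp_neq[symmetric])
  have "((\<lambda>x. tail F (x + a) / tail F x - 1) \<longlongrightarrow> 1 - 1) at_top"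
    using assms by (intro tendsto_diff tendsto_const) (simp add: long_tailed_def)
  also have "(\<lambda>x. tail F (x + a) / tail F x - 1) = (\<lambda>x. (tail F (x + a) - tail F x) / tail F x)"
    using pos by (simp add: fun_eq_iff diff_divide_distrib less_imp_neq[symmetric])
  finally show "((\<lambda>x. (tail F (x + a) - tail F x) / tail F x) \<longlongrightarrow> 0) at_top"
    by simp
qed

section \<open>Distributions insensitive to shifts on the scale of a reference tail\<close>

definition insensitive :: "real measure \<Rightarrow> real measure \<Rightarrow> bool" where
  "insensitive F G \<longleftrightarrow> real_distribution G \<and> tail G \<in> O[at_top](tail F) \<and>
     (\<forall>a. (\<lambda>x. tail G (x + a) - tail G x) \<in> o[at_top](tail F))"

lemma insensitiveD:
  assumes "insensitive F G"
  shows "real_distribution G" "tail G \<in> O[at_top](tail F)"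
    "(\<lambda>x. tail G (x + a) - tail G x) \<in> o[at_top](tail F)"
  using assms by (auto simp: insensitive_def)

lemma insensitive_refl:
  "real_distribution F \<Longrightarrow> long_tailed F \<Longrightarrow> insensitive F F"
  by (simp add: insensitive_def long_tailed_shift_negligible)

text \<open>
  The tail of the sum is of the order of \<open>tail F\<close>, so a shift changes both \<open>tail F + tail G\<close> and
  \<open>tail F\<close> by \<open>o(tail F)\<close>; subtract.
\<close>
lemma insensitive_if_sum_long_tailed:
  assumes "real_distribution F" "long_tailed F" "real_distribution G"
    and sum: "long_tailed (add_measure F G)" and dom: "tail G \<in> O[at_top](tail F)"
  shows "insensitive F G"
proof -
  have "(\<lambda>x. tail G (x + a) - tail G x) \<in> o[at_top](tail F)" for a
  proof -
    have "(\<lambda>x. tail F x + tail G x) \<in> O[at_top](tail F)"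
      by (intro sum_in_bigo dom) simp
    then have "(\<lambda>x. (tail F (x + a) + tail G (x + a)) - (tail F x + tail G x)) \<in> o[at_top](tail F)"
      using long_tailed_shift_negligible[OF sum, of a]
      unfolding tail_add_measure[OF assms(1,3)] by (rule landau_o.small_big_trans[rotated])
    from sum_in_smallo(2)[OF this long_tailed_shift_negligible[OF assms(2), of a]]
    show ?thesis
      by (simp add: algebra_simps)
  qed
  with assms show ?thesis
    by (simp add: insensitive_def)
qed

lemma eventually_shift_le:
  assumes "insensitive F G" "e > 0"
  shows "\<forall>\<^sub>F x in at_top. \<bar>tail G (x + a) - tail G x\<bar> \<le> e * tail F x"
  using landau_o.smallD[OF insensitiveD(3)[OF assms(1)] assms(2)] by simp

text \<open>
  Once \<open>tail F\<close> is big-O of \<open>tail G\<close>, the change under a shift is small relative to \<open>tail G\<close> itself.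
\<close>
lemma long_tailed_if_insensitive:
  assumes F: "long_tailed F" and G: "insensitive F G" and FG: "tail F \<in> O[at_top](tail G)"
  shows "long_tailed G"
proof -
  interpret G: real_distribution G
    using G by (rule insensitiveD)
  have "tail G x > 0" for x
  proof -
    obtain c where c: "c > 0" "\<forall>\<^sub>F y in at_top. norm (tail F y) \<le> c * norm (tail G y)"
      using FG by (rule landau_o.bigE)
    from eventually_conj[OF c(2) eventually_ge_at_top[of x]]
    obtain y where y: "norm (tail F y) \<le> c * norm (tail G y)" "y \<ge> x"
      unfolding eventually_at_top_linorder by blast
    have "0 < c * tail G y"
      using y(1) F by (auto simp: long_tailed_def intro: less_le_trans)
    then have "0 < tail G y"
      using c(1) by (simp add: zero_less_mult_iff)
    also have "\<dots> \<le> tail G x"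
      using y(2) by (intro tail_antimono G.real_distribution_axioms)
    finally show ?thesis .
  qed
  moreover have "((\<lambda>x. tail G (x + a) / tail G x) \<longlongrightarrow> 1) at_top" for a
  proof -
    have "(\<lambda>x. tail G (x + a) - tail G x) \<in> o[at_top](tail G)"
      using insensitiveD(3)[OF G] FG by (rule landau_o.small_big_trans)
    from tendsto_add[OF smalloD_tendsto[OF this] tendsto_const[of 1]]
    show ?thesis
      using \<open>\<And>x. tail G x > 0\<close> by (simp add: diff_divide_distrib less_imp_neq[symmetric])
  qed
  ultimately show ?thesis
    by (simp add: long_tailed_def G.finite_borel_measure_M)
qed

section \<open>Splitting a convolution at a level\<close>

definition both_large :: "real \<Rightarrow> real \<Rightarrow> (real \<times> real) set" where
  "both_large a x = {p. a < fst p \<and> a < snd p \<and> x < fst p + snd p}"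

lemma borel_both_large [simp, measurable]: "both_large a x \<in> sets (borel \<Otimes>\<^sub>M borel)"
proof -
  have "{p \<in> space (borel \<Otimes>\<^sub>M borel). a < fst p \<and> a < snd p \<and> x < fst p + snd p}
      \<in> sets (borel \<Otimes>\<^sub>M borel)"
    by measurable
  then show ?thesis
    by (simp add: both_large_def space_pair_measure)
qed

locale two_distributions = G: real_distribution G + H: real_distribution H for G H
begin

sublocale pair_prob_space G H ..

lemma sets_pair [measurable_cong]: "sets (G \<Otimes>\<^sub>M H) = sets (borel \<Otimes>\<^sub>M borel)"
  by (intro sets_pair_measure_cong) auto

lemma real_distribution_convolution: "real_distribution (G \<star> H)"
  unfolding convolution_def
  by (intro real_distribution_distr) measurable

lemma tail_convolution: "tail (G \<star> H) x = prob {p. x < fst p + snd p}"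
proof -
  have "(\<lambda>(u, v). u + v) \<in> borel_measurable (G \<Otimes>\<^sub>M H)"
    by measurable
  then show ?thesis
    unfolding tail_def convolution_def
    by (subst measure_distr) (auto simp: space_pair_measure intro!: arg_cong[where f = prob])
qed

lemma prob_rectangle:
  assumes "A \<in> sets borel" "B \<in> sets borel"
  shows "prob (A \<times> B) = measure G A * measure H B"
  using assms by (simp add: measure_def H.emeasure_pair_measure_Times enn2real_mult)

text \<open>
  A sum beyond \<open>x\<close> forces one of the coordinates beyond \<open>x - a\<close> unless both exceed \<open>a\<close>.
\<close>
lemma tail_convolution_le:
  "tail (G \<star> H) x \<le> tail H (x - a) + tail G (x - a) + prob (both_large a x)"
proof -
  have "tail (G \<star> H) x \<le> prob ((UNIV \<times> {x - a<..} \<union> {x - a<..} \<times> UNIV) \<union> both_large a x)"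
    unfolding tail_convolution
  proof (rule finite_measure_mono)
    show "{p. x < fst p + snd p} \<subseteq> (UNIV \<times> {x - a<..} \<union> {x - a<..} \<times> UNIV) \<union> both_large a x"
      by (auto simp: both_large_def)
  qed measurable
  also have "\<dots> \<le> prob (UNIV \<times> {x - a<..}) + prob ({x - a<..} \<times> UNIV) + prob (both_large a x)"
    by (intro order_trans[OF measure_Un_le] add_right_mono) auto
  also have "\<dots> = tail H (x - a) + tail G (x - a) + prob (both_large a x)"
    using G.prob_space H.prob_space by (simp add: prob_rectangle tail_def)
  finally show ?thesis .
qed

text \<open>
  Three disjoint ways for the sum to exceed \<open>x\<close>. The condition on \<open>x\<close> keeps the two rectangles
  disjoint. The shift is by \<open>+ a\<close> because the moderate coordinate may be as low as \<open>-a\<close>.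
\<close>
lemma tail_convolution_ge:
  assumes "0 \<le> x"
  shows "measure G {-a<..a} * tail H (x + a) + measure H {-a<..a} * tail G (x + a)
    + prob (both_large a x) \<le> tail (G \<star> H) x"
proof -
  have "measure G {-a<..a} * tail H (x + a) + measure H {-a<..a} * tail G (x + a)
      + prob (both_large a x) =
    prob ({-a<..a} \<times> {x + a<..}) + prob ({x + a<..} \<times> {-a<..a}) + prob (both_large a x)"
    by (simp add: prob_rectangle tail_def)
  also have "\<dots> = prob (({-a<..a} \<times> {x + a<..} \<union> {x + a<..} \<times> {-a<..a}) \<union> both_large a x)"
  proof -
    have "{-a<..a} \<times> {x + a<..} \<inter> {x + a<..} \<times> {-a<..a} = {}"
      using assms by auto
    moreover have "({-a<..a} \<times> {x + a<..} \<union> {x + a<..} \<times> {-a<..a}) \<inter> both_large a x = {}"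
      by (auto simp: both_large_def)
    ultimately show ?thesis
      by (subst finite_measure_Union; (subst finite_measure_Union)?) (simp_all del: Times_Int_Times)
  qed
  also have "\<dots> \<le> tail (G \<star> H) x"
    unfolding tail_convolution
  proof (rule finite_measure_mono)
    have "{p \<in> space (G \<Otimes>\<^sub>M H). x < fst p + snd p} \<in> events"
      by measurable
    then show "{p. x < fst p + snd p} \<in> events"
      by (simp add: space_pair_measure)
  qed (auto simp: both_large_def)
  finally show ?thesis .
qed

text \<open>
  Given one coordinate \<open>v > a\<close>, the other has to exceed \<open>max a (x - v)\<close>. So only values of the tail
  at points from \<open>a\<close> on enter, which is what allows an asymptotic bound between tails to be used
  inside the integral. Integrating in either order gives the symmetry \<open>both_large_swap\<close>.
\<close>
lemma emeasure_both_large: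
  "emeasure (G \<Otimes>\<^sub>M H) (both_large a x) =
    (\<integral>\<^sup>+v. (if a < v then ennreal (tail G (max a (x - v))) else 0) \<partial>H)"
proof -
  have "(\<lambda>u. (u, v)) -` both_large a x = (if a < v then {max a (x - v)<..} else {})" for v
    by (auto simp: both_large_def)
  then show ?thesis
    by (subst emeasure_pair_measure_alt2)
       (auto simp: tail_def G.emeasure_eq_measure intro!: nn_integral_cong)
qed

lemma emeasure_both_large':
  "emeasure (G \<Otimes>\<^sub>M H) (both_large a x) =
    (\<integral>\<^sup>+u. (if a < u then ennreal (tail H (max a (x - u))) else 0) \<partial>G)"
proof -
  have "Pair u -` both_large a x = (if a < u then {max a (x - u)<..} else {})" for u
    by (auto simp: both_large_def)
  then show ?thesis
    by (subst H.emeasure_pair_measure_alt)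
       (auto simp: tail_def H.emeasure_eq_measure intro!: nn_integral_cong)
qed

end

lemma two_distributionsI: "real_distribution G \<Longrightarrow> real_distribution H \<Longrightarrow> two_distributions G H"
  by (simp add: two_distributions_def)

lemma both_large_swap:
  assumes "real_distribution G" "real_distribution H"
  shows "measure (G \<Otimes>\<^sub>M H) (both_large a x) = measure (H \<Otimes>\<^sub>M G) (both_large a x)"
  using two_distributions.emeasure_both_large[OF two_distributionsI[OF assms], of a x]
    two_distributions.emeasure_both_large'[OF two_distributionsI[OF assms(2,1)], of a x]
  by (simp add: measure_def)

lemma both_large_mono:
  assumes "real_distribution F" "real_distribution G" "real_distribution H" "0 \<le> c"
    and le: "\<And>y. a \<le> y \<Longrightarrow> tail G y \<le> c * tail F y"
  shows "measure (G \<Otimes>\<^sub>M H) (both_large a x) \<le> c * measure (F \<Otimes>\<^sub>M H) (both_large a x)"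
proof -
  interpret GH: two_distributions G H
    using assms by (simp add: two_distributionsI)
  interpret FH: two_distributions F H
    using assms by (simp add: two_distributionsI)
  have meas: "(\<lambda>v. if a < v then ennreal (tail F (max a (x - v))) else 0) \<in> borel_measurable H"
    using borel_measurable_tail[OF assms(1)] by measurable
  have "emeasure (G \<Otimes>\<^sub>M H) (both_large a x)
      \<le> (\<integral>\<^sup>+v. ennreal c * (if a < v then ennreal (tail F (max a (x - v))) else 0) \<partial>H)"
    unfolding GH.emeasure_both_large using le \<open>0 \<le> c\<close>
    by (intro nn_integral_mono) (auto simp flip: ennreal_mult intro!: ennreal_leI)
  also have "\<dots> = ennreal c * emeasure (F \<Otimes>\<^sub>M H) (both_large a x)"
    using meas by (simp add: FH.emeasure_both_large nn_integral_cmult)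
  finally show ?thesis
    using \<open>0 \<le> c\<close> by (simp add: GH.emeasure_eq_measure FH.emeasure_eq_measure flip: ennreal_mult)
qed

section \<open>Convolution of insensitive distributions\<close>

text \<open>
  If more than \<open>1 - e\<close> of the mass of \<open>F\<close> is moderate, the two rectangles of
  \<open>tail_convolution_ge\<close> carry at least \<open>2 * (1 - e)\<^sup>2 * tail F x\<close>, whereas subexponentiality allows at most \<open>(2 + e) * tail F x\<close> in total.
  The difference is at most \<open>5 * e * tail F x\<close>.
\<close>
lemma subexponential_both_large:
  assumes F: "subexponential F" and e: "0 < e" "e \<le> 1"
    and mass: "1 - e < measure F {-a<..a}"
  shows "\<forall>\<^sub>F x in at_top. measure (F \<Otimes>\<^sub>M F) (both_large a x) \<le> 5 * e * tail F x"
proof -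
  have dF: "real_distribution F" and lF: "long_tailed F"
    and conv: "(\<lambda>x. tail (F \<star> F) x - 2 * tail F x) \<in> o[at_top](tail F)"
    using F by (auto simp: subexponential_def)
  interpret FF: two_distributions F F
    using dF by (simp add: two_distributionsI)
  from eventually_shift_le[OF insensitive_refl[OF dF lF] e(1), of a]
    landau_o.smallD[OF conv e(1)] eventually_ge_at_top[of 0]
  show ?thesis
  proof eventually_elim
    case (elim x)
    have "(1 - e) * ((1 - e) * tail F x) \<le> measure F {-a<..a} * tail F (x + a)"
      using elim(1) mass e mult_nonneg_nonneg[of "1 - e" "tail F x"]
      by (intro mult_mono) (auto simp: algebra_simps)
    moreover have "2 * (measure F {-a<..a} * tail F (x + a)) + FF.prob (both_large a x)
        \<le> tail (F \<star> F) x"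
      using FF.tail_convolution_ge[OF elim(3), of a] by (simp add: mult.commute)
    moreover have "tail (F \<star> F) x \<le> 2 * tail F x + e * tail F x"
      using elim(2) by simp
    moreover have "0 \<le> 2 * e * e * tail F x"
      using e by simp
    ultimately show ?case
      by (simp add: algebra_simps)
  qed
qed

lemma eventually_tail_le_at_top:
  assumes "tail G \<in> O[at_top](tail F)"
  obtains c where "c > 0" "\<forall>\<^sub>F a in at_top. \<forall>y\<ge>a. tail G y \<le> c * tail F y"
proof -
  obtain c where "c > 0" "\<forall>\<^sub>F y in at_top. norm (tail G y) \<le> c * norm (tail F y)"
    using assms by (rule landau_o.bigE)
  then have "\<forall>\<^sub>F a in at_top. \<forall>y\<ge>a. tail G y \<le> c * tail F y"
    by (auto simp: eventually_at_top_linorder intro: order_trans)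
  with \<open>c > 0\<close> show ?thesis
    by (rule that)
qed

text \<open>
  The order of choices matters: the constants \<open>c\<close> and \<open>c'\<close> come first, then the precision \<open>e\<close>, then
  a level \<open>a\<close> beyond which the bounds by \<open>c * tail F\<close> and \<open>c' * tail F\<close> hold and for which
  \<open>{-a<..a}\<close> carries almost all the mass, and only then is \<open>x\<close> sent to infinity.
\<close>
lemma tail_convolution_insensitive:
  assumes F: "subexponential F" and G: "insensitive F G" and H: "insensitive F H"
  shows "(\<lambda>x. tail (G \<star> H) x - (tail G x + tail H x)) \<in> o[at_top](tail F)"
proof (rule landau_o.smallI)
  fix d :: real
  assume "d > 0"
  have dF: "real_distribution F"
    using F by (simp add: subexponential_def)
  note dG = insensitiveD(1)[OF G] and dH = insensitiveD(1)[OF H]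
  interpret GH: two_distributions G H
    using dG dH by (simp add: two_distributionsI)
  obtain c where c: "c > 0" "\<forall>\<^sub>F a in at_top. \<forall>y\<ge>a. tail G y \<le> c * tail F y"
    using eventually_tail_le_at_top[OF insensitiveD(2)[OF G]] .
  obtain c' where c': "c' > 0" "\<forall>\<^sub>F a in at_top. \<forall>y\<ge>a. tail H y \<le> c' * tail F y"
    using eventually_tail_le_at_top[OF insensitiveD(2)[OF H]] .
  \<comment> \<open>Two shifts cost \<open>2 * e\<close>, the mass missing from the rectangles costs \<open>(c + c') * e\<close>, and the
      both-large event costs \<open>c * c' * (5 * e)\<close>.\<close>
  define K where "K = 2 + c + c' + 5 * (c * c')"
  define e where "e = min 1 (d / K)"
  have K: "K > 0"
    unfolding K_def using c(1) c'(1) by (intro add_pos_nonneg) auto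
  then have e: "0 < e" "e \<le> 1" and Ke: "K * e \<le> d"
    using \<open>d > 0\<close> by (auto simp: e_def min_def field_simps)
  have "\<forall>\<^sub>F a in at_top. (\<forall>y\<ge>a. tail G y \<le> c * tail F y) \<and> (\<forall>y\<ge>a. tail H y \<le> c' * tail F y) \<and>
      1 - e < measure F {-a<..a} \<and> 1 - e < measure G {-a<..a} \<and> 1 - e < measure H {-a<..a}"
    using c(2) c'(2) dF dG dH e by (intro eventually_conj eventually_mass_near_one)
  then obtain a where a: "\<And>y. a \<le> y \<Longrightarrow> tail G y \<le> c * tail F y"
      "\<And>y. a \<le> y \<Longrightarrow> tail H y \<le> c' * tail F y"
      "1 - e < measure F {-a<..a}" "1 - e < measure G {-a<..a}" "1 - e < measure H {-a<..a}"
    by (auto dest!: eventually_happens'[OF trivial_limit_at_top_linorder])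
  have large: "GH.prob (both_large a x) \<le> c * c' * measure (F \<Otimes>\<^sub>M F) (both_large a x)" for x
  proof -
    have "GH.prob (both_large a x) \<le> c * measure (H \<Otimes>\<^sub>M F) (both_large a x)"
      using both_large_mono[OF dF dG dH _ a(1)] c(1) by (simp add: both_large_swap[OF dH dF])
    also have "\<dots> \<le> c * (c' * measure (F \<Otimes>\<^sub>M F) (both_large a x))"
      using c(1) c'(1) by (intro mult_left_mono both_large_mono dF dH a(2)) auto
    finally show ?thesis
      by simp
  qed
  from eventually_shift_le[OF G e(1), of a] eventually_shift_le[OF G e(1), of "- a"]
    eventually_shift_le[OF H e(1), of a] eventually_shift_le[OF H e(1), of "- a"]
    subexponential_both_large[OF F e a(3)] eventually_ge_at_top[of "max 0 a"]
  show "\<forall>\<^sub>F x in at_top. norm (tail (G \<star> H) x - (tail G x + tail H x)) \<le> d * norm (tail F x)"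
  proof eventually_elim
    case (elim x)
    have F0: "0 \<le> tail F x"
      by simp
    \<comment> \<open>One rectangle: \<open>m\<close> is the moderate mass, \<open>u\<close> the other tail at \<open>x\<close> and \<open>u'\<close> its value at
        \<open>x + a\<close>.\<close>
    have lower: "u - (c'' + 1) * e * tail F x \<le> m * u'"
      if "\<bar>u' - u\<bar> \<le> e * tail F x" "u \<le> c'' * tail F x" "1 - e < m" "0 \<le> u'" for u u' m c''
    proof -
      have "e * u \<le> e * (c'' * tail F x)"
        using that(2) e by (intro mult_left_mono) auto
      then have "u - (c'' + 1) * e * tail F x \<le> (1 - e) * (u - e * tail F x)"
        using mult_nonneg_nonneg[OF zero_le_square[of e] F0] by (simp add: algebra_simps)
      also have "\<dots> \<le> (1 - e) * u'"
        using that(1) e by (intro mult_left_mono) auto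
      also have "\<dots> \<le> m * u'"
        using that by (intro mult_right_mono) auto
      finally show ?thesis .
    qed
    have "tail G x + tail H x - (2 + c + c') * e * tail F x \<le> tail (G \<star> H) x"
    proof -
      have "tail G x - (c + 1) * e * tail F x \<le> measure H {-a<..a} * tail G (x + a)"
        using elim(6) by (intro lower[OF elim(1) a(1) a(5)]) auto
      moreover have "tail H x - (c' + 1) * e * tail F x \<le> measure G {-a<..a} * tail H (x + a)"
        using elim(6) by (intro lower[OF elim(3) a(2) a(4)]) auto
      moreover have "measure G {-a<..a} * tail H (x + a) + measure H {-a<..a} * tail G (x + a)
          \<le> tail (G \<star> H) x"
        using elim(6) GH.tail_convolution_ge[of x a]
          measure_nonneg[of "G \<Otimes>\<^sub>M H" "both_large a x"] by linarith
      moreover have "(2 + c + c') * e * tail F x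
          = (c + 1) * e * tail F x + (c' + 1) * e * tail F x"
        by (simp add: algebra_simps)
      ultimately show ?thesis
        by linarith
    qed
    moreover have "(2 + c + c') * e * tail F x \<le> K * e * tail F x"
      unfolding K_def using c(1) c'(1) e F0 by (intro mult_right_mono) auto
    moreover have "tail (G \<star> H) x \<le> tail G x + tail H x + K * e * tail F x"
    proof -
      have "GH.prob (both_large a x) \<le> c * c' * (5 * e * tail F x)"
        using c(1) c'(1) by (intro order_trans[OF large] mult_left_mono elim(5)) auto
      moreover have "0 \<le> (c + c') * e * tail F x"
        using c(1) c'(1) e F0 by simp
      ultimately show ?thesis
        using GH.tail_convolution_le[of x a] elim(2,4) by (simp add: K_def algebra_simps)
    qed
    moreover have "K * e * tail F x \<le> d * tail F x"
      using Ke F0 by (rule mult_right_mono)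
    ultimately show ?case
      by (simp add: abs_le_iff)
  qed
qed

lemma insensitive_convolution:
  assumes F: "subexponential F" and G: "insensitive F G" and H: "insensitive F H"
  shows "insensitive F (G \<star> H)"
proof -
  interpret GH: two_distributions G H
    using G H by (simp add: two_distributionsI insensitiveD)
  have lF: "long_tailed F" and dF: "real_distribution F"
    using F by (auto simp: subexponential_def)
  define r where "r x = tail (G \<star> H) x - (tail G x + tail H x)" for x
  have r: "r \<in> o[at_top](tail F)"
    unfolding r_def using assms by (rule tail_convolution_insensitive)
  have split: "tail (G \<star> H) x = tail G x + tail H x + r x" for x
    by (simp add: r_def)
  have "tail (G \<star> H) \<in> O[at_top](tail F)"
    unfolding split
    by (intro sum_in_bigo insensitiveD(2)[OF G] insensitiveD(2)[OF H] landau_o.small_imp_big r)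
  moreover have "(\<lambda>x. tail (G \<star> H) (x + a) - tail (G \<star> H) x) \<in> o[at_top](tail F)" for a
  proof -
    have "(\<lambda>x. tail F (x + a) - tail F x + tail F x) \<in> O[at_top](tail F)"
      by (rule sum_in_bigo(1)[OF landau_o.small_imp_big[OF long_tailed_shift_negligible[OF lF]]])
        simp
    moreover have "filterlim (\<lambda>x. x + a) at_top at_top"
      by (subst add.commute)
         (intro filterlim_tendsto_add_at_top[OF tendsto_const] filterlim_ident)
    ultimately have "(\<lambda>x. r (x + a)) \<in> o[at_top](tail F)"
      using landau_o.small_big_trans[OF landau_o.small.compose[OF r]] by simp
    then have "(\<lambda>x. (tail G (x + a) - tail G x) + (tail H (x + a) - tail H x) + (r (x + a) - r x))
        \<in> o[at_top](tail F)"
      by (intro sum_in_smallo insensitiveD(3)[OF G] insensitiveD(3)[OF H] r)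
    then show ?thesis
      by (simp add: split algebra_simps)
  qed
  ultimately show ?thesis
    by (simp add: insensitive_def GH.real_distribution_convolution)
qed

text \<open>
  Since \<open>tail H\<close> is nonnegative, \<open>tail G\<close> exceeds the tail of the convolution by at most
  \<open>o(tail F)\<close>. This error is absorbed by taking it below half of \<open>tail F\<close>.
\<close>
lemma reference_tail_le_convolution:
  assumes F: "subexponential F" and G: "insensitive F G" and H: "insensitive F H"
    and FG: "tail F \<in> O[at_top](tail G)"
  shows "tail F \<in> O[at_top](tail (G \<star> H))"
proof -
  obtain c where c: "c > 0" "\<forall>\<^sub>F x in at_top. norm (tail F x) \<le> c * norm (tail G x)"
    using FG by (rule landau_o.bigE)
  have "\<forall>\<^sub>F x in at_top. norm (tail (G \<star> H) x - (tail G x + tail H x))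
      \<le> 1 / (2 * c) * norm (tail F x)"
    using c(1) by (intro landau_o.smallD[OF tail_convolution_insensitive[OF F G H]]) simp
  with c(2) have "\<forall>\<^sub>F x in at_top. norm (tail F x) \<le> 2 * c * norm (tail (G \<star> H) x)"
  proof eventually_elim
    case (elim x)
    have "tail G x \<le> tail (G \<star> H) x + 1 / (2 * c) * tail F x"
      using elim(2) tail_nonneg[of H x] unfolding real_norm_def abs_of_nonneg[OF tail_nonneg]
      by linarith
    then have "c * tail G x \<le> c * tail (G \<star> H) x + tail F x / 2"
      using c(1) by (simp add: field_simps)
    with elim(1) show ?case
      by simp
  qed
  with c(1) show ?thesis
    by (intro landau_o.bigI[of "2 * c"]) auto
qed

lemma subexponential_if_insensitive:
  assumes F: "subexponential F" and G: "insensitive F G" and FG: "tail F \<in> O[at_top](tail G)"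
  shows "subexponential G"
proof -
  have "(\<lambda>x. tail (G \<star> G) x - (tail G x + tail G x)) \<in> o[at_top](tail G)"
    using tail_convolution_insensitive[OF F G G] FG by (rule landau_o.small_big_trans)
  then show ?thesis
    using insensitiveD(1)[OF G] long_tailed_if_insensitive[OF _ G FG] F
    by (simp add: subexponential_def)
qed

theorem theorem17:
  fixes F :: "real measure" and G :: "nat \<Rightarrow> real measure" and n :: nat
  assumes "1 \<le> n"
    and "subexponential F"
    and "\<And>k. k \<in> {1..n} \<Longrightarrow> real_distribution (G k)"
    and "\<And>k. k \<in> {1..n} \<Longrightarrow> long_tailed (add_measure F (G k))"
    and "\<And>k. k \<in> {1..n} \<Longrightarrow> tail (G k) \<in> O[at_top](tail F)"
    and "long_tailed (G 1)"
    and "weakly_tail_equivalent (G 1) F"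
  shows "subexponential (iter_convolution G n) \<and> weakly_tail_equivalent (iter_convolution G n) F"
proof -
  have ins: "insensitive F (G k)" if "k \<in> {1..n}" for k
    using assms(2-5) that by (intro insensitive_if_sum_long_tailed) (auto simp: subexponential_def)
  have "insensitive F (iter_convolution G m) \<and> tail F \<in> O[at_top](tail (iter_convolution G m))"
    if "1 \<le> m" "m \<le> n" for m
    using that
  proof (induction m rule: dec_induct)
    case base
    then show ?case
      using ins[of 1] assms(7) by (simp add: iter_convolution_1[simplified] weakly_tail_equivalent_def)
  next
    case (step m)
    then show ?case
      using ins[of "Suc m"] assms(2)
      by (auto simp: iter_convolution_Suc intro: insensitive_convolution reference_tail_le_convolution)
  qed
  from this[OF assms(1) order_refl] show ?thesis
    using subexponential_if_insensitive[OF assms(2)] insensitiveD(2)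
    by (auto simp: weakly_tail_equivalent_def)
qed

end
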